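(* Let $\mathcal{S}=(V,\Sigma,\delta)$ be a nondeterministic fuzzy transition system, $\alpha\in[0,1]$ and $k\in\mathbb{N}$. Then $\approx_k^{\alpha}$ is the greatest fixed point of $F_k^{\alpha}$, i.e. $\approx_k^{\alpha}=\bigcup\{R\in\mathcal{P}(V\times V): R\subseteq F_k^{\alpha}(R)\}$.
   Context: Let $\otimes$ be a fixed left-continuous $t$-norm on $[0,1]$: commutative, associative, increasing, with neutral element $1$, and $r\otimes\bigvee_i r_i=\bigvee_i (r\otimes r_i)$. Its residuum is $t\rightarrow r=\bigvee\{s\in[0,1]: s\otimes t\le r\}$. $\wedge,\vee$ (and $\bigwedge,\bigvee$) are min, max (inf, sup) in $[0,1]$; $\mathbb{N}$ contains $0$. $V$ is a nonempty finite set; $\mathcal{R}(V)$ is the set of fuzzy subsets of $V$ (maps $V\to[0,1]$), also called distributions. For $p\in\mathcal{R}(V)$ and $X\subseteq V$, $p(X)=\bigvee_{x\in X}p(x)$ (with $p(\emptyset)=0$). A nondeterministic fuzzy transition system (NFTS) is a triple $\mathcal{S}=(V,\Sigma,\delta)$ with $\Sigma$ a set of labels and $\delta\subseteq V\times\Sigma\times\mathcal{R}(V)$; $\delta(u,\tau)=\{p:(u,\tau,p)\in\delta\}$, and $u\overset{\tau}{\longrightarrow}p$ means $p\in\delta(u,\tau)$. For $R\subseteq V\times V$: $\overrightarrow{R}_u=\{v:(u,v)\in R\}$, $\overleftarrow{R}_u=\{v:(v,u)\in R\}$, and $\widetilde{S}(p,q,R)=\bigwedge_{u\in V}\big((p(u)\rightarrow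 q(\overrightarrow{R}_u))\wedge(q(u)\rightarrow p(\overleftarrow{R}_u))\big)$. The lifted relation is $R_\alpha^{\dagger}=\{(p,q)\in\mathcal{R}(V)\times\mathcal{R}(V):\widetilde{S}(p,q,R)\ge\alpha\}$. $k$-limited $\alpha$-bisimilarity $\approx_k^{\alpha}\subseteq V\times V$: $u\approx_0^\alpha v$ for all $u,v$; and $u\approx_{i+1}^\alpha v$ iff for each $\tau\in\Sigma$: $u\overset{\tau}{\longrightarrow}p$ implies there is $v\overset{\tau}{\longrightarrow}q$ with $(p,q)\in(\approx_i^\alpha)_\alpha^\dagger$; and $v\overset{\tau}{\longrightarrow}q$ implies there is $u\overset{\tau}{\longrightarrow}p$ with $(p,q)\in(\approx_i^\alpha)_\alpha^\dagger$. For $X\subseteq V$, $\mathrm{Succ}(X)=\{v\in V:\exists u\in X,\tau\in\Sigma,p\in\delta(u,\tau)\text{ with }p(v)>0\}$. For $R\subseteq V\times V$ let $\mathrm{dom}(R)=\{u:\exists v,(u,v)\in R\}$ and $\mathrm{ran}(R)=\{v:\exists u,(u,v)\in R\}$. The functions $F_k^\alpha:\mathcal{P}(V\times V)\to\mathcal{P}(V\times V)$ are defined recursively: $F_0^\alpha(R)=R$; and $F_{i+1}^\alpha(R)$ is the set of $(u,v)\in V\times V$ such that, with $G=F_i^\alpha(\mathrm{Succ}(\mathrm{dom}(R))\times\mathrm{Succ}(\mathrm{ran}(R)))$, for every $\tau\in\Sigma$: for every $u\overset{\tau}{\longrightarrow}p$ there is $v\overset{\tau}{\longrightarrow}q$ with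 $(p,q)\in G_\alpha^\dagger$, and for every $v\overset{\tau}{\longrightarrow}q$ there is $u\overset{\tau}{\longrightarrow}p$ with $(p,q)\in G_\alpha^\dagger$. *)

theory Defs
  imports Complex_Main "HOL-Library.FuncSet"
begin

text \<open>The complete lattice [0,1] is represented by the real interval \<open>{0..1}\<close>.
  Inserting 0 (resp. 1) makes the real supremum (infimum) of a subset agree with the one taken
  in [0,1], also for the empty set.\<close>

definition unit_Sup :: "real set \<Rightarrow> real" where
  "unit_Sup A = Sup (insert 0 A)"

definition unit_Inf :: "real set \<Rightarrow> real" where
  "unit_Inf A = Inf (insert 1 A)"

definition left_continuous_tnorm :: "(real \<Rightarrow> real \<Rightarrow> real) \<Rightarrow> bool" where
  "left_continuous_tnorm T \<longleftrightarrow>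
     (\<forall>r\<in>{0..1}. \<forall>s\<in>{0..1}. T r s \<in> {0..1}) \<and>
     (\<forall>r\<in>{0..1}. \<forall>s\<in>{0..1}. T r s = T s r) \<and>
     (\<forall>r\<in>{0..1}. \<forall>s\<in>{0..1}. \<forall>t\<in>{0..1}. T (T r s) t = T r (T s t)) \<and>
     (\<forall>r\<in>{0..1}. \<forall>s\<in>{0..1}. \<forall>r'\<in>{0..1}. \<forall>s'\<in>{0..1}.
        r \<le> r' \<longrightarrow> s \<le> s' \<longrightarrow> T r s \<le> T r' s') \<and>
     (\<forall>r\<in>{0..1}. T r 1 = r) \<and>
     (\<forall>r\<in>{0..1}. \<forall>A. A \<subseteq> {0..1} \<longrightarrow> T r (unit_Sup A) = unit_Sup (T r ` A))"

definition residuum :: "(real \<Rightarrow> real \<Rightarrow> real) \<Rightarrow> real \<Rightarrow> real \<Rightarrow> real" where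
  "residuum T t r = unit_Sup {s \<in> {0..1}. T s t \<le> r}"

definition distributions :: "'v set \<Rightarrow> ('v \<Rightarrow> real) set" where
  "distributions V = V \<rightarrow>\<^sub>E {0..1}"

definition mass :: "('v \<Rightarrow> real) \<Rightarrow> 'v set \<Rightarrow> real" where
  "mass p X = unit_Sup (p ` X)"

definition nfts :: "'v set \<Rightarrow> 'l set \<Rightarrow> ('v \<times> 'l \<times> ('v \<Rightarrow> real)) set \<Rightarrow> bool" where
  "nfts V \<Sigma> \<delta> \<longleftrightarrow> finite V \<and> V \<noteq> {} \<and> \<delta> \<subseteq> V \<times> \<Sigma> \<times> distributions V"

definition transitions ::
    "('v \<times> 'l \<times> ('v \<Rightarrow> real)) set \<Rightarrow> 'v \<Rightarrow> 'l \<Rightarrow> ('v \<Rightarrow> real) set" where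
  "transitions \<delta> u \<tau> = {p. (u, \<tau>, p) \<in> \<delta>}"

text \<open>For a relation \<open>R\<close>, the forward and backward images of a state \<open>u\<close> are
  \<open>R `` {u}\<close> and \<open>R\<inverse> `` {u}\<close>.\<close>

definition lift_degree ::
    "(real \<Rightarrow> real \<Rightarrow> real) \<Rightarrow> 'v set \<Rightarrow> ('v \<Rightarrow> real) \<Rightarrow> ('v \<Rightarrow> real) \<Rightarrow> ('v \<times> 'v) set \<Rightarrow> real" where
  "lift_degree T V p q R =
     unit_Inf ((\<lambda>u. min (residuum T (p u) (mass q (R `` {u})))
                        (residuum T (q u) (mass p (R\<inverse> `` {u})))) ` V)"

definition lift_rel ::
    "(real \<Rightarrow> real \<Rightarrow> real) \<Rightarrow> 'v set \<Rightarrow> real \<Rightarrow> ('v \<times> 'v) set \<Rightarrow> (('v \<Rightarrow> real) \<times> ('v \<Rightarrow> real)) set" where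
  "lift_rel T V \<alpha> R =
     {(p, q) \<in> distributions V \<times> distributions V. lift_degree T V p q R \<ge> \<alpha>}"

text \<open>The transfer (back-and-forth) condition shared by the recursive clauses of
  limited bisimilarity and of the functions \<open>F\<close>: \<open>G\<close> is the relation to be lifted.\<close>

definition transfer_rel ::
    "(real \<Rightarrow> real \<Rightarrow> real) \<Rightarrow> 'v set \<Rightarrow> 'l set \<Rightarrow> ('v \<times> 'l \<times> ('v \<Rightarrow> real)) set \<Rightarrow> real \<Rightarrow>
     ('v \<times> 'v) set \<Rightarrow> ('v \<times> 'v) set" where
  "transfer_rel T V \<Sigma> \<delta> \<alpha> G =
     {(u, v) \<in> V \<times> V. \<forall>\<tau>\<in>\<Sigma>.
        (\<forall>p\<in>transitions \<delta> u \<tau>. \<exists>q\<in>transitions \<delta> v \<tau>. (p, q) \<in> lift_rel T V \<alpha> G) \<and>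
        (\<forall>q\<in>transitions \<delta> v \<tau>. \<exists>p\<in>transitions \<delta> u \<tau>. (p, q) \<in> lift_rel T V \<alpha> G)}"

primrec limited_bisim ::
    "(real \<Rightarrow> real \<Rightarrow> real) \<Rightarrow> 'v set \<Rightarrow> 'l set \<Rightarrow> ('v \<times> 'l \<times> ('v \<Rightarrow> real)) set \<Rightarrow> real \<Rightarrow>
     nat \<Rightarrow> ('v \<times> 'v) set" where
  "limited_bisim T V \<Sigma> \<delta> \<alpha> 0 = V \<times> V"
| "limited_bisim T V \<Sigma> \<delta> \<alpha> (Suc i) = transfer_rel T V \<Sigma> \<delta> \<alpha> (limited_bisim T V \<Sigma> \<delta> \<alpha> i)"

definition succs ::
    "'v set \<Rightarrow> 'l set \<Rightarrow> ('v \<times> 'l \<times> ('v \<Rightarrow> real)) set \<Rightarrow> 'v set \<Rightarrow> 'v set" where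
  "succs V \<Sigma> \<delta> X = {v \<in> V. \<exists>u\<in>X. \<exists>\<tau>\<in>\<Sigma>. \<exists>p\<in>transitions \<delta> u \<tau>. p v > 0}"

primrec F_fun ::
    "(real \<Rightarrow> real \<Rightarrow> real) \<Rightarrow> 'v set \<Rightarrow> 'l set \<Rightarrow> ('v \<times> 'l \<times> ('v \<Rightarrow> real)) set \<Rightarrow> real \<Rightarrow>
     nat \<Rightarrow> ('v \<times> 'v) set \<Rightarrow> ('v \<times> 'v) set" where
  "F_fun T V \<Sigma> \<delta> \<alpha> 0 R = R"
| "F_fun T V \<Sigma> \<delta> \<alpha> (Suc i) R =
     transfer_rel T V \<Sigma> \<delta> \<alpha>
       (F_fun T V \<Sigma> \<delta> \<alpha> i (succs V \<Sigma> \<delta> (Domain R) \<times> succs V \<Sigma> \<delta> (Range R)))"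

end

theory Submission
  imports Defs
begin

text \<open>The function \<open>F_fun k\<close> runs the recursion of \<open>limited_bisim k\<close>, but starts it from the pairs
  that are \<open>k\<close> steps away from \<open>Domain R \<times> Range R\<close> instead of from all of \<open>V \<times> V\<close>. Starting
  from fewer pairs can only lose pairs, so \<open>F_fun k R\<close> lies below \<open>limited_bisim k\<close> for every
  \<open>R \<subseteq> V \<times> V\<close> (\<open>F_fun_subset_limited_bisim\<close>); this bounds all fixed and post-fixed points.

  Conversely, nothing is lost on the pairs that matter. The lifting of a relation to two
  distributions \<open>p\<close> and \<open>q\<close> depends only on its pairs in the product of the two supports: a
  state of degree 0 has residuum 1, and it contributes nothing to a mass
  (\<open>lift_degree_mono_on_supports\<close>). The distributions reached from \<open>A\<close> and \<open>B\<close> have their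
  supports in \<open>succs A\<close> and \<open>succs B\<close>, so the transfer condition on \<open>A \<times> B\<close> only sees the
  lifted relation on \<open>succs A \<times> succs B\<close> (\<open>transfer_rel_mono_on_succs\<close>). By induction on \<open>k\<close>,
  \<open>limited_bisim k\<close> restricted to \<open>A \<times> B\<close> is contained in \<open>F_fun k (A \<times> B)\<close>. Applied to the
  domain and range of \<open>limited_bisim k\<close> itself, this makes \<open>limited_bisim k\<close> a post-fixed point,
  hence by the upper bound a fixed point, and the greatest one.\<close>

lemma residuum_le_one: "residuum T t r \<le> 1"
  unfolding residuum_def unit_Sup_def by (rule cSup_least) auto

lemma residuum_mono:
  assumes "r \<le> r'"
  shows "residuum T t r \<le> residuum T t r'"
  unfolding residuum_def unit_Sup_def
proof (rule cSup_subset_mono)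
  show "bdd_above (insert 0 {s \<in> {0..1}. T s t \<le> r'})"
    by (rule bdd_aboveI[of _ 1]) auto
qed (use assms in auto)

lemma residuum_zero_left:
  assumes "left_continuous_tnorm T" "0 \<le> r"
  shows "residuum T 0 r = 1"
proof (rule antisym[OF residuum_le_one])
  have comm: "\<forall>r\<in>{0..1}. \<forall>s\<in>{0..1}. T r s = T s r" and unit: "\<forall>r\<in>{0..1}. T r 1 = r"
    using assms(1) unfolding left_continuous_tnorm_def
    by - (elim conjE, assumption)+
  have "T 1 0 = T 0 1"
    using comm[rule_format, of 1 0] by simp
  also have "\<dots> = 0"
    using unit by simp
  finally have "T 1 0 = 0" .
  with assms(2) show "1 \<le> residuum T 0 r"
    unfolding residuum_def unit_Sup_def
    by (intro cSup_upper) (auto intro!: bdd_aboveI[of _ 1])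
qed

lemma distribution_bounds:
  assumes "p \<in> distributions V" "x \<in> V"
  shows "0 \<le> p x" "p x \<le> 1"
  using assms by (auto simp: distributions_def PiE_def Pi_def)

lemma bdd_above_distribution_image:
  assumes "p \<in> distributions V" "X \<subseteq> V"
  shows "bdd_above (insert 0 (p ` X))"
proof (rule bdd_aboveI[of _ 1])
  fix r
  assume "r \<in> insert 0 (p ` X)"
  then show "r \<le> 1"
    using distribution_bounds(2)[OF assms(1)] assms(2) by auto
qed

lemma mass_nonneg:
  assumes "p \<in> distributions V" "X \<subseteq> V"
  shows "0 \<le> mass p X"
  unfolding mass_def unit_Sup_def
  using bdd_above_distribution_image[OF assms] by (intro cSup_upper) auto

lemma mass_mono_on_support:
  assumes "p \<in> distributions V" "X \<subseteq> V" "Y \<subseteq> V"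
    and "\<And>x. x \<in> X \<Longrightarrow> 0 < p x \<Longrightarrow> x \<in> Y"
  shows "mass p X \<le> mass p Y"
proof -
  have "p x = 0 \<or> x \<in> Y" if "x \<in> X" for x
    using that assms(2,4) distribution_bounds(1)[OF assms(1), of x] by force
  then have "insert 0 (p ` X) \<subseteq> insert 0 (p ` Y)"
    by auto
  then show ?thesis
    unfolding mass_def unit_Sup_def
    by (intro cSup_subset_mono bdd_above_distribution_image[OF assms(1,3)]) auto
qed

text \<open>The two halves of \<open>lift_degree\<close> are exchanged by swapping \<open>p\<close> with \<open>q\<close> and inverting the
  relation, so one half suffices. It holds because a state outside the support of \<open>p\<close> already
  attains the greatest value 1.\<close>

lemma residuum_mass_mono_on_supports:
  assumes "left_continuous_tnorm T" "p \<in> distributions V" "q \<in> distributions V"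
    and "R \<subseteq> V \<times> V" "R' \<subseteq> V \<times> V"
    and "\<And>x y. (x, y) \<in> R \<Longrightarrow> 0 < p x \<Longrightarrow> 0 < q y \<Longrightarrow> (x, y) \<in> R'"
    and "u \<in> V"
  shows "residuum T (p u) (mass q (R `` {u})) \<le> residuum T (p u) (mass q (R' `` {u}))"
proof (cases "p u = 0")
  case True
  have "0 \<le> mass q (R' `` {u})"
    using assms(3,5) by (intro mass_nonneg) auto
  then show ?thesis
    using True assms(1) by (simp add: residuum_zero_left residuum_le_one)
next
  case False
  then have "0 < p u"
    using distribution_bounds(1)[OF assms(2,7)] by simp
  with assms(3-6) show ?thesis
    by (intro residuum_mono mass_mono_on_support[of q V]) auto
qed

lemma lift_degree_mono_on_supports:
  assumes "left_continuous_tnorm T" "finite V"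
    and "p \<in> distributions V" "q \<in> distributions V"
    and "R \<subseteq> V \<times> V" "R' \<subseteq> V \<times> V"
    and "\<And>x y. (x, y) \<in> R \<Longrightarrow> 0 < p x \<Longrightarrow> 0 < q y \<Longrightarrow> (x, y) \<in> R'"
  shows "lift_degree T V p q R \<le> lift_degree T V p q R'"
proof -
  let ?f = "\<lambda>R u. min (residuum T (p u) (mass q (R `` {u})))
                      (residuum T (q u) (mass p (R\<inverse> `` {u})))"
  have le: "?f R u \<le> ?f R' u" if "u \<in> V" for u
  proof (rule min.mono)
    show "residuum T (p u) (mass q (R `` {u})) \<le> residuum T (p u) (mass q (R' `` {u}))"
      using assms that by (intro residuum_mass_mono_on_supports) auto
    show "residuum T (q u) (mass p (R\<inverse> `` {u})) \<le> residuum T (q u) (mass p (R'\<inverse> `` {u}))"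
      using assms that by (intro residuum_mass_mono_on_supports[of T q V p]) auto
  qed
  have "Inf (insert 1 (?f R ` V)) \<le> Inf (insert 1 (?f R' ` V))"
  proof (rule cInf_mono)
    show "bdd_below (insert 1 (?f R ` V))"
      using assms(2) by (intro bdd_below_finite) simp
    show "\<exists>a\<in>insert 1 (?f R ` V). a \<le> b" if "b \<in> insert 1 (?f R' ` V)" for b
      using that le by blast
  qed simp
  then show ?thesis
    unfolding lift_degree_def unit_Inf_def .
qed

text \<open>With \<open>G\<close> and \<open>G'\<close> compared only on \<open>succs A \<times> succs B\<close>, this serves both inclusions: the upper
  bound on \<open>F_fun\<close>, where \<open>G \<subseteq> G'\<close> holds outright, and the lower bound, where it holds only there.\<close>

lemma transfer_rel_mono_on_succs:
  assumes "left_continuous_tnorm T" "nfts V \<Sigma> \<delta>"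
    and "G \<subseteq> V \<times> V" "G' \<subseteq> V \<times> V"
    and "\<And>x y. (x, y) \<in> G \<Longrightarrow> x \<in> succs V \<Sigma> \<delta> A \<Longrightarrow> y \<in> succs V \<Sigma> \<delta> B \<Longrightarrow> (x, y) \<in> G'"
    and "u \<in> A" "v \<in> B"
    and "(u, v) \<in> transfer_rel T V \<Sigma> \<delta> \<alpha> G"
  shows "(u, v) \<in> transfer_rel T V \<Sigma> \<delta> \<alpha> G'"
proof -
  have lift: "(p, q) \<in> lift_rel T V \<alpha> G'"
    if "\<tau> \<in> \<Sigma>" and p: "p \<in> transitions \<delta> u \<tau>" and q: "q \<in> transitions \<delta> v \<tau>"
      and G: "(p, q) \<in> lift_rel T V \<alpha> G" for \<tau> p q
  proof -
    have pq: "p \<in> distributions V" "q \<in> distributions V"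
      using G by (auto simp: lift_rel_def)
    have "lift_degree T V p q G \<le> lift_degree T V p q G'"
    proof (rule lift_degree_mono_on_supports[OF assms(1) _ pq assms(3,4)])
      show "finite V"
        using assms(2) by (simp add: nfts_def)
      fix x y
      assume xy: "(x, y) \<in> G" "0 < p x" "0 < q y"
      then have "x \<in> succs V \<Sigma> \<delta> A" "y \<in> succs V \<Sigma> \<delta> B"
        using assms(3,6,7) that(1) p q unfolding succs_def by blast+
      then show "(x, y) \<in> G'"
        using xy(1) assms(5) by blast
    qed
    with G show ?thesis
      by (auto simp: lift_rel_def)
  qed
  have V: "u \<in> V" "v \<in> V"
    using assms(8) by (auto simp: transfer_rel_def)
  have forward: "\<exists>q\<in>transitions \<delta> v \<tau>. (p, q) \<in> lift_rel T V \<alpha> G'"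
    if "\<tau> \<in> \<Sigma>" "p \<in> transitions \<delta> u \<tau>" for \<tau> p
    using assms(8) that lift[OF that] unfolding transfer_rel_def by blast
  have backward: "\<exists>p\<in>transitions \<delta> u \<tau>. (p, q) \<in> lift_rel T V \<alpha> G'"
    if "\<tau> \<in> \<Sigma>" "q \<in> transitions \<delta> v \<tau>" for \<tau> q
    using assms(8) that lift[OF that(1) _ that(2)] unfolding transfer_rel_def by blast
  show ?thesis
    unfolding transfer_rel_def using V forward backward by blast
qed

lemma transfer_rel_subset: "transfer_rel T V \<Sigma> \<delta> \<alpha> G \<subseteq> V \<times> V"
  by (auto simp: transfer_rel_def)

lemma limited_bisim_subset: "limited_bisim T V \<Sigma> \<delta> \<alpha> k \<subseteq> V \<times> V"
  by (cases k) (simp_all add: transfer_rel_subset)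

lemma F_fun_subset:
  assumes "R \<subseteq> V \<times> V"
  shows "F_fun T V \<Sigma> \<delta> \<alpha> k R \<subseteq> V \<times> V"
  using assms by (cases k) (simp_all add: transfer_rel_subset)

lemma succs_subset: "succs V \<Sigma> \<delta> X \<subseteq> V"
  by (auto simp: succs_def)

lemma F_fun_subset_limited_bisim:
  assumes "left_continuous_tnorm T" "nfts V \<Sigma> \<delta>" "R \<subseteq> V \<times> V"
  shows "F_fun T V \<Sigma> \<delta> \<alpha> k R \<subseteq> limited_bisim T V \<Sigma> \<delta> \<alpha> k"
  using assms(3)
proof (induction k arbitrary: R)
  case 0
  then show ?case by simp
next
  case (Suc k)
  let ?S = "succs V \<Sigma> \<delta> (Domain R) \<times> succs V \<Sigma> \<delta> (Range R)"
  have S: "?S \<subseteq> V \<times> V"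
    using succs_subset by (intro Sigma_mono)
  have "(u, v) \<in> transfer_rel T V \<Sigma> \<delta> \<alpha> (limited_bisim T V \<Sigma> \<delta> \<alpha> k)"
    if "(u, v) \<in> transfer_rel T V \<Sigma> \<delta> \<alpha> (F_fun T V \<Sigma> \<delta> \<alpha> k ?S)" for u v
    using Suc.IH[OF S] that
    by (intro transfer_rel_mono_on_succs[OF assms(1,2) F_fun_subset[OF S] limited_bisim_subset,
          where A = UNIV and B = UNIV]) auto
  then show ?case by auto
qed

text \<open>The induction needs arbitrary rectangles, because the recursion of \<open>F_fun\<close> moves from
  \<open>A \<times> B\<close> to \<open>succs A \<times> succs B\<close>.\<close>

lemma limited_bisim_rectangle_subset_F_fun:
  assumes "left_continuous_tnorm T" "nfts V \<Sigma> \<delta>"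
  shows "limited_bisim T V \<Sigma> \<delta> \<alpha> k \<inter> A \<times> B \<subseteq> F_fun T V \<Sigma> \<delta> \<alpha> k (A \<times> B)"
proof (induction k arbitrary: A B)
  case 0
  then show ?case by simp
next
  case (Suc k)
  let ?S = "succs V \<Sigma> \<delta> A \<times> succs V \<Sigma> \<delta> B"
  have S: "?S \<subseteq> V \<times> V"
    using succs_subset by (intro Sigma_mono)
  show ?case
  proof (rule subrelI)
    fix u v
    assume uv: "(u, v) \<in> limited_bisim T V \<Sigma> \<delta> \<alpha> (Suc k) \<inter> A \<times> B"
    have "(u, v) \<in> transfer_rel T V \<Sigma> \<delta> \<alpha> (F_fun T V \<Sigma> \<delta> \<alpha> k ?S)"
      using Suc.IH[of "succs V \<Sigma> \<delta> A" "succs V \<Sigma> \<delta> B"] uv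
      by (intro transfer_rel_mono_on_succs[OF assms limited_bisim_subset F_fun_subset[OF S],
            where A = A and B = B]) auto
    \<comment> \<open>The factors of the rectangle are its domain and range only because it contains \<open>(u, v)\<close>.\<close>
    moreover have "Domain (A \<times> B) = A" "Range (A \<times> B) = B"
      using uv by auto
    ultimately show "(u, v) \<in> F_fun T V \<Sigma> \<delta> \<alpha> (Suc k) (A \<times> B)"
      by simp
  qed
qed

lemma limited_bisim_subset_F_fun:
  assumes "left_continuous_tnorm T" "nfts V \<Sigma> \<delta>"
  shows "limited_bisim T V \<Sigma> \<delta> \<alpha> k \<subseteq> F_fun T V \<Sigma> \<delta> \<alpha> k (limited_bisim T V \<Sigma> \<delta> \<alpha> k)"
proof (cases k)
  case 0
  then show ?thesis by simp
next
  case (Suc i)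
  let ?B = "limited_bisim T V \<Sigma> \<delta> \<alpha> k"
  let ?H = "Domain ?B \<times> Range ?B"
  have "?B \<subseteq> ?B \<inter> ?H"
    by auto
  also have "\<dots> \<subseteq> F_fun T V \<Sigma> \<delta> \<alpha> k ?H"
    by (rule limited_bisim_rectangle_subset_F_fun[OF assms])
  \<comment> \<open>For positive \<open>k\<close> only the domain and the range of the argument enter, and a relation shares
      them with its rectangular hull.\<close>
  also have "\<dots> = F_fun T V \<Sigma> \<delta> \<alpha> k ?B"
  proof -
    have "Domain ?H = Domain ?B" "Range ?H = Range ?B"
      by blast+
    then show ?thesis
      unfolding Suc F_fun.simps by simp
  qed
  finally show ?thesis .
qed

theorem proposition4p2:
  fixes T :: "real \<Rightarrow> real \<Rightarrow> real"
    and V :: "'v set" and \<Sigma> :: "'l set" and \<delta> :: "('v \<times> 'l \<times> ('v \<Rightarrow> real)) set"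
    and \<alpha> :: real and k :: nat
  assumes "left_continuous_tnorm T"
    and "nfts V \<Sigma> \<delta>"
    and "\<alpha> \<in> {0..1}"
  shows "F_fun T V \<Sigma> \<delta> \<alpha> k (limited_bisim T V \<Sigma> \<delta> \<alpha> k) = limited_bisim T V \<Sigma> \<delta> \<alpha> k
    \<and> (\<forall>R\<in>Pow (V \<times> V). F_fun T V \<Sigma> \<delta> \<alpha> k R = R \<longrightarrow> R \<subseteq> limited_bisim T V \<Sigma> \<delta> \<alpha> k)
    \<and> limited_bisim T V \<Sigma> \<delta> \<alpha> k = \<Union> {R \<in> Pow (V \<times> V). R \<subseteq> F_fun T V \<Sigma> \<delta> \<alpha> k R}"
proof -
  let ?B = "limited_bisim T V \<Sigma> \<delta> \<alpha> k"
  note upper = F_fun_subset_limited_bisim[OF assms(1,2)]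
  note lower = limited_bisim_subset_F_fun[OF assms(1,2)]
  have "F_fun T V \<Sigma> \<delta> \<alpha> k ?B = ?B"
    by (rule antisym[OF upper[OF limited_bisim_subset] lower])
  moreover have "R \<subseteq> ?B" if "R \<in> Pow (V \<times> V)" "R \<subseteq> F_fun T V \<Sigma> \<delta> \<alpha> k R" for R
    using that upper[of R] by blast
  moreover have "?B \<in> {R \<in> Pow (V \<times> V). R \<subseteq> F_fun T V \<Sigma> \<delta> \<alpha> k R}"
    using limited_bisim_subset lower by blast
  ultimately show ?thesis
    by (intro conjI ballI impI; blast)
qed

end
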